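(* Let $\gamma : I\to\mathbb{R}^3$ be a smooth curve on an open interval $I$ parametrized by arc length $s$, with nowhere vanishing curvature and unit tangent $T$. Let $c$ be a real constant with $c-s>0$ for all $s\in I$, and let $\widetilde\gamma=\gamma+(c-s)T$ be the involute of $\gamma$. Then the tangent indicatrix of $\widetilde\gamma$ is a spherical helix if and only if $\widetilde\gamma$ is a slant helix. In this case, the tangent indicatrix of $\widetilde\gamma$ is also a slant helix on the unit sphere.
   Context: The tangent indicatrix of $\widetilde\gamma$ is the curve traced on the unit sphere by its unit tangent vector $\widetilde T$. For a curve with arc-length parameter $u$, curvature $k>0$ and torsion $t$, put $g=t/k$. The curve is a generalized helix if $g$ is constant (the value $0$ is allowed); a spherical helix is a generalized helix lying on the unit sphere. The curve is a slant helix if its principal normal lines make a constant angle with a fixed direction; equivalently (known characterization of Izumiya and Takeuchi), the function $\frac{dg/du}{k(1+g^2)^{3/2}}$ is constant. *)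

theory Defs
  imports "HOL-Analysis.Analysis"
begin

abbreviation vderiv :: "(real \<Rightarrow> 'a::real_normed_vector) \<Rightarrow> real \<Rightarrow> 'a" where
  "vderiv f \<equiv> (\<lambda>s. vector_derivative f (at s))"

text \<open>Smoothness on an open set of parameters. A curve is a total function, but only its
  values on the parameter set are relevant, since all derivatives are local.\<close>

definition smooth_curve_on :: "real set \<Rightarrow> (real \<Rightarrow> 'a::real_normed_vector) \<Rightarrow> bool" where
  "smooth_curve_on I f \<longleftrightarrow> (\<forall>n. \<forall>s\<in>I. ((vderiv ^^ n) f) differentiable (at s))"

text \<open>The derivative of \<open>f\<close> with respect to the arc length \<open>u\<close> of the regular curve \<open>c\<close>: since
  \<open>du/ds\<close> is the speed of \<open>c\<close>, the chain rule gives \<open>df/du = (df/ds) / |dc/ds|\<close>. The Frenet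
  apparatus below is therefore the one of the arc-length parametrization of \<open>c\<close>, written in
  terms of an arbitrary regular parameter.\<close>

definition arclen_deriv ::
  "(real \<Rightarrow> real^3) \<Rightarrow> (real \<Rightarrow> 'a::real_normed_vector) \<Rightarrow> real \<Rightarrow> 'a" where
  "arclen_deriv c f s = vderiv f s /\<^sub>R norm (vderiv c s)"

definition unit_tangent :: "(real \<Rightarrow> real^3) \<Rightarrow> real \<Rightarrow> real^3" where
  "unit_tangent c = arclen_deriv c c"

definition curvature :: "(real \<Rightarrow> real^3) \<Rightarrow> real \<Rightarrow> real" where
  "curvature c s = norm (arclen_deriv c (unit_tangent c) s)"

definition principal_normal :: "(real \<Rightarrow> real^3) \<Rightarrow> real \<Rightarrow> real^3" where
  "principal_normal c s = arclen_deriv c (unit_tangent c) s /\<^sub>R curvature c s"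

definition binormal :: "(real \<Rightarrow> real^3) \<Rightarrow> real \<Rightarrow> real^3" where
  "binormal c s = cross3 (unit_tangent c s) (principal_normal c s)"

text \<open>Sign convention: \<open>dB/du = - t N\<close>.\<close>

definition torsion :: "(real \<Rightarrow> real^3) \<Rightarrow> real \<Rightarrow> real" where
  "torsion c s = - (arclen_deriv c (binormal c) s \<bullet> principal_normal c s)"

definition frenet_curve :: "real set \<Rightarrow> (real \<Rightarrow> real^3) \<Rightarrow> bool" where
  "frenet_curve I c \<longleftrightarrow>
     smooth_curve_on I c \<and> (\<forall>s\<in>I. vderiv c s \<noteq> 0) \<and> (\<forall>s\<in>I. curvature c s > 0)"

definition arclength_parametrized :: "real set \<Rightarrow> (real \<Rightarrow> real^3) \<Rightarrow> bool" where
  "arclength_parametrized I c \<longleftrightarrow> (\<forall>s\<in>I. norm (vderiv c s) = 1)"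

definition generalized_helix :: "real set \<Rightarrow> (real \<Rightarrow> real^3) \<Rightarrow> bool" where
  "generalized_helix I c \<longleftrightarrow>
     frenet_curve I c \<and> (\<exists>g0. \<forall>s\<in>I. torsion c s / curvature c s = g0)"

definition on_unit_sphere :: "real set \<Rightarrow> (real \<Rightarrow> real^3) \<Rightarrow> bool" where
  "on_unit_sphere I c \<longleftrightarrow> c ` I \<subseteq> sphere 0 1"

definition spherical_helix :: "real set \<Rightarrow> (real \<Rightarrow> real^3) \<Rightarrow> bool" where
  "spherical_helix I c \<longleftrightarrow> generalized_helix I c \<and> on_unit_sphere I c"

text \<open>The principal normal makes the constant angle \<open>\<theta>\<close> with the unit vector \<open>d\<close>, both vectors
  having norm 1.\<close>

definition slant_helix :: "real set \<Rightarrow> (real \<Rightarrow> real^3) \<Rightarrow> bool" where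
  "slant_helix I c \<longleftrightarrow>
     frenet_curve I c \<and>
     (\<exists>d \<theta>. norm d = 1 \<and> (\<forall>s\<in>I. principal_normal c s \<bullet> d = cos \<theta>))"

definition tangent_indicatrix :: "(real \<Rightarrow> real^3) \<Rightarrow> real \<Rightarrow> real^3" where
  "tangent_indicatrix c = unit_tangent c"

definition involute :: "(real \<Rightarrow> real^3) \<Rightarrow> real \<Rightarrow> real \<Rightarrow> real^3" where
  "involute \<gamma> c s = \<gamma> s + (c - s) *\<^sub>R unit_tangent \<gamma> s"

end

theory Submission
  imports Defs
begin

text \<open>
  The key is a duality between a Frenet curve \<open>\<alpha>\<close> and its tangent indicatrix \<open>\<beta>\<close>. As a map,
  \<open>\<beta>\<close> is the unit tangent field of \<open>\<alpha>\<close>, so the unit tangent of \<open>\<beta>\<close> is the normalized derivative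
  of that field, which is the principal normal of \<open>\<alpha>\<close> (\<open>unit_tangent_tangent_indicatrix\<close>).
  By Lancret's theorem (\<open>generalized_helix_iff_constant_angle\<close>) \<open>\<beta>\<close> is a generalized helix
  exactly when its unit tangent makes a constant angle with a fixed direction; read as a
  condition on the principal normal of \<open>\<alpha>\<close>, this says that \<open>\<alpha>\<close> is a slant helix. Finally, a
  generalized helix is always a slant helix (\<open>generalized_helix_imp_slant_helix\<close>):
  differentiating \<open>T \<bullet> d = const\<close> gives \<open>N \<bullet> d = 0\<close>, the constant angle being \<open>\<pi>/2\<close>.

  What remains is to see that the curves involved are Frenet curves. A regular curve on the
  unit sphere has positive curvature (\<open>frenet_curve_if_regular_spherical\<close>), which covers \<open>\<beta>\<close>.
  The involute \<open>\<gamma> + (c - s) T\<close> of a unit-speed curve has derivative \<open>(c - s) \<kappa> N\<close>, so it is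
  regular with unit tangent \<open>N\<close>, and \<open>N' \<bullet> T = - \<kappa>\<close> prevents \<open>N'\<close> from vanishing
  (\<open>frenet_curve_involute\<close>).
\<close>

section \<open>Calculus of smooth curves\<close>

text \<open>Smoothness cut off at a finite order, so that closure properties can be proved by induction
  on the order: the derivative of a product or of \<open>1/|f|\<close> is an expression in functions of which
  one order less is needed.\<close>

primrec times_differentiable_on :: "nat \<Rightarrow> real set \<Rightarrow> (real \<Rightarrow> 'a::real_normed_vector) \<Rightarrow> bool" where
  "times_differentiable_on 0 I f \<longleftrightarrow> True"
| "times_differentiable_on (Suc n) I f \<longleftrightarrow>
     (\<forall>s\<in>I. f differentiable (at s)) \<and> times_differentiable_on n I (vderiv f)"

lemma times_differentiable_on_iff:
  "times_differentiable_on n I f \<longleftrightarrow> (\<forall>k<n. \<forall>s\<in>I. ((vderiv ^^ k) f) differentiable (at s))"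
proof (induction n arbitrary: f)
  case (Suc n)
  have "(\<forall>k<Suc n. \<forall>s\<in>I. ((vderiv ^^ k) f) differentiable (at s)) \<longleftrightarrow>
        (\<forall>s\<in>I. f differentiable (at s)) \<and>
        (\<forall>k<n. \<forall>s\<in>I. ((vderiv ^^ Suc k) f) differentiable (at s))"
    using less_Suc_eq_0_disj by auto
  then show ?case
    by (simp add: Suc.IH funpow_Suc_right del: funpow.simps)
qed simp

lemma smooth_curve_on_iff_times:
  "smooth_curve_on I f \<longleftrightarrow> (\<forall>n. times_differentiable_on n I f)"
  unfolding smooth_curve_on_def times_differentiable_on_iff by blast

lemma smooth_curve_on_has_deriv:
  assumes "smooth_curve_on I f" "s \<in> I"
  shows "(f has_vector_derivative vderiv f s) (at s)"
proof -
  from assms have "((vderiv ^^ 0) f) differentiable (at s)"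
    unfolding smooth_curve_on_def by blast
  then show ?thesis by (simp add: vector_derivative_works)
qed

lemma smooth_curve_on_vderiv:
  assumes "smooth_curve_on I f"
  shows "smooth_curve_on I (vderiv f)"
  using assms unfolding smooth_curve_on_iff_times by (metis times_differentiable_on.simps(2))

lemma times_differentiable_on_decrease:
  "times_differentiable_on (Suc n) I f \<Longrightarrow> times_differentiable_on n I f"
  by (simp add: times_differentiable_on_iff del: times_differentiable_on.simps)

lemma times_differentiable_on_cong:
  assumes "open I" "\<And>s. s \<in> I \<Longrightarrow> f s = g s" "times_differentiable_on n I f"
  shows "times_differentiable_on n I g"
  using assms(2,3)
proof (induction n arbitrary: f g)
  case (Suc n)
  have d: "(g has_vector_derivative vderiv f s) (at s)" if "s \<in> I" for s
  proof (rule has_vector_derivative_transform_within_open[OF _ \<open>open I\<close> that])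
    show "(f has_vector_derivative vderiv f s) (at s)"
      using Suc.prems that by (auto simp: vector_derivative_works)
  qed (use Suc.prems in auto)
  have "times_differentiable_on n I (vderiv g)"
    by (rule Suc.IH[of "vderiv f"]) (use Suc.prems(2) d[THEN vector_derivative_at] in simp_all)
  with d show ?case
    by (auto intro: differentiableI_vector)
qed simp

lemma smooth_curve_on_cong:
  assumes "open I" "\<And>s. s \<in> I \<Longrightarrow> f s = g s" "smooth_curve_on I f"
  shows "smooth_curve_on I g"
  using assms times_differentiable_on_cong unfolding smooth_curve_on_iff_times by blast

lemma times_differentiable_on_SucI:
  assumes "open I" "\<And>s. s \<in> I \<Longrightarrow> (f has_vector_derivative f' s) (at s)"
    and "times_differentiable_on n I f'"
  shows "times_differentiable_on (Suc n) I f"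
proof -
  have "times_differentiable_on n I (vderiv f)"
    by (rule times_differentiable_on_cong[OF assms(1) _ assms(3)])
       (use assms(2)[THEN vector_derivative_at] in simp)
  then show ?thesis
    using assms(2) by (auto intro: differentiableI_vector)
qed

lemma times_differentiable_on_has_deriv:
  assumes "times_differentiable_on (Suc n) I f" "s \<in> I"
  shows "(f has_vector_derivative vderiv f s) (at s)"
  using assms by (simp add: vector_derivative_works)

lemma times_differentiable_on_const: "times_differentiable_on n I (\<lambda>s. a)"
  by (induction n arbitrary: a) auto

lemma times_differentiable_on_add:
  assumes "open I" "times_differentiable_on n I f" "times_differentiable_on n I g"
  shows "times_differentiable_on n I (\<lambda>s. f s + g s)"
  using assms(2,3)
proof (induction n arbitrary: f g)
  case (Suc n)
  show ?case
  proof (rule times_differentiable_on_SucI[OF assms(1)])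
    show "times_differentiable_on n I (\<lambda>s. vderiv f s + vderiv g s)"
      using Suc by simp
  qed (intro has_vector_derivative_add times_differentiable_on_has_deriv[OF Suc.prems(1)]
        times_differentiable_on_has_deriv[OF Suc.prems(2)])
qed simp

lemma (in bounded_bilinear) times_differentiable_on:
  assumes "open I" "times_differentiable_on n I f" "times_differentiable_on n I g"
  shows "times_differentiable_on n I (\<lambda>s. prod (f s) (g s))"
  using assms(2,3)
proof (induction n arbitrary: f g)
  case (Suc n)
  show ?case
  proof (rule times_differentiable_on_SucI[OF assms(1)])
    show "times_differentiable_on n I (\<lambda>s. prod (f s) (vderiv g s) + prod (vderiv f s) (g s))"
      using Suc.prems
      by (intro times_differentiable_on_add assms(1) Suc.IH)
         (auto intro: times_differentiable_on_decrease)
  qed (intro has_vector_derivative times_differentiable_on_has_deriv[OF Suc.prems(1)]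
        times_differentiable_on_has_deriv[OF Suc.prems(2)])
qed simp

text \<open>The derivative is written as a polynomial in \<open>f\<close>, \<open>f'\<close> and \<open>1/|f|\<close> itself, so that the
  induction on the order of differentiability closes without treating square roots or
  reciprocals separately.\<close>

lemma has_vector_derivative_inverse_norm:
  fixes f :: "real \<Rightarrow> 'a::real_inner"
  assumes "(f has_vector_derivative f') (at s)" "f s \<noteq> 0"
  shows "((\<lambda>s. inverse (norm (f s))) has_vector_derivative
           (- (f s \<bullet> f') * (inverse (norm (f s)) * (inverse (norm (f s)) * inverse (norm (f s)))))) (at s)"
proof -
  have "((\<lambda>s. inverse (norm (f s))) has_derivative
          (\<lambda>h. - (inverse (norm (f s)) * (sgn (f s) \<bullet> (h *\<^sub>R f')) * inverse (norm (f s))))) (at s)"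
    using assms unfolding has_vector_derivative_def
    by (auto intro!: derivative_eq_intros has_derivative_compose[OF _ has_derivative_norm]
          simp: inner_commute)
  then show ?thesis
    unfolding has_vector_derivative_def
    by (rule has_derivative_eq_rhs) (auto simp: sgn_div_norm divide_inverse)
qed

lemma times_differentiable_on_inverse_norm:
  fixes f :: "real \<Rightarrow> 'a::real_inner"
  assumes "open I" "times_differentiable_on n I f" "\<And>s. s \<in> I \<Longrightarrow> f s \<noteq> 0"
  shows "times_differentiable_on n I (\<lambda>s. inverse (norm (f s)))"
  using assms(2)
proof (induction n)
  case (Suc n)
  define h where "h s = inverse (norm (f s))" for s
  note f = times_differentiable_on_decrease[OF Suc.prems]
  have f': "times_differentiable_on n I (vderiv f)"
    using Suc.prems by simp
  have h: "times_differentiable_on n I h"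
    using Suc.IH[OF f] unfolding h_def .
  note mult = bounded_bilinear.times_differentiable_on[OF bounded_bilinear_mult assms(1)]
  have "times_differentiable_on n I (\<lambda>s. - 1 * (f s \<bullet> vderiv f s) * (h s * (h s * h s)))"
    by (intro mult h f f' times_differentiable_on_const assms(1)
          bounded_bilinear.times_differentiable_on[OF bounded_bilinear_inner])
  then have "times_differentiable_on n I (\<lambda>s. - (f s \<bullet> vderiv f s) * (h s * (h s * h s)))"
    by simp
  then show ?case
    unfolding h_def
    by (rule times_differentiable_on_SucI[OF assms(1) has_vector_derivative_inverse_norm, rotated 2])
       (use Suc.prems times_differentiable_on_has_deriv assms(3) in blast)+
qed simp

lemma smooth_curve_on_normalize:
  fixes f :: "real \<Rightarrow> 'a::real_inner"
  assumes "open I" "smooth_curve_on I f" "\<And>s. s \<in> I \<Longrightarrow> f s \<noteq> 0"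
  shows "smooth_curve_on I (\<lambda>s. f s /\<^sub>R norm (f s))"
  using assms unfolding smooth_curve_on_iff_times
  by (intro allI bounded_bilinear.times_differentiable_on[OF bounded_bilinear_scaleR]
        times_differentiable_on_inverse_norm) auto

section \<open>The Frenet frame of a regular curve\<close>

lemma norm_const_imp_orthogonal_deriv:
  fixes f :: "real \<Rightarrow> 'a::real_inner"
  assumes "open I" "s \<in> I" "\<And>s. s \<in> I \<Longrightarrow> norm (f s) = 1" "(f has_vector_derivative f') (at s)"
  shows "f s \<bullet> f' = 0"
proof -
  have "((\<lambda>s. f s \<bullet> f s) has_vector_derivative (f s \<bullet> f' + f' \<bullet> f s)) (at s)"
    by (rule bounded_bilinear.has_vector_derivative[OF bounded_bilinear_inner assms(4) assms(4)])
  moreover have "((\<lambda>s. f s \<bullet> f s) has_vector_derivative 0) (at s)"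
    by (rule has_vector_derivative_transform_within_open[OF has_vector_derivative_const[of 1] assms(1,2)])
       (simp add: assms(3) dot_square_norm)
  ultimately have "f s \<bullet> f' + f' \<bullet> f s = 0"
    by (rule vector_derivative_unique_at)
  then show ?thesis by (simp add: inner_commute)
qed

lemma orthogonal_imp_inner_deriv:
  fixes f g :: "real \<Rightarrow> 'a::real_inner"
  assumes "open I" "s \<in> I" "\<And>s. s \<in> I \<Longrightarrow> f s \<bullet> g s = 0"
    and "(f has_vector_derivative f') (at s)" "(g has_vector_derivative g') (at s)"
  shows "f' \<bullet> g s = - (f s \<bullet> g')"
proof -
  have "((\<lambda>s. f s \<bullet> g s) has_vector_derivative (f s \<bullet> g' + f' \<bullet> g s)) (at s)"
    by (rule bounded_bilinear.has_vector_derivative[OF bounded_bilinear_inner assms(4) assms(5)])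
  moreover have "((\<lambda>s. f s \<bullet> g s) has_vector_derivative 0) (at s)"
    by (rule has_vector_derivative_transform_within_open[OF has_vector_derivative_const[of 0] assms(1,2)])
       (simp add: assms(3))
  ultimately have "f s \<bullet> g' + f' \<bullet> g s = 0"
    by (rule vector_derivative_unique_at)
  then show ?thesis by simp
qed

text \<open>The part \<open>y\<close> of \<open>x\<close> orthogonal to \<open>t\<close> and \<open>n\<close> satisfies \<open>y \<times> (t \<times> n) = 0\<close> by Lagrange's
  formula, and a second use of that formula then makes \<open>y\<close> a multiple of \<open>t \<times> n\<close>.\<close>

lemma orthonormal_cross3_expansion:
  fixes x t n :: "real^3"
  assumes "norm t = 1" "norm n = 1" "t \<bullet> n = 0"
  shows "x = (x \<bullet> t) *\<^sub>R t + (x \<bullet> n) *\<^sub>R n + (x \<bullet> cross3 t n) *\<^sub>R cross3 t n"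
proof -
  define b where "b = cross3 t n"
  define y where "y = x - (x \<bullet> t) *\<^sub>R t - (x \<bullet> n) *\<^sub>R n"
  have tt: "t \<bullet> t = 1" "n \<bullet> n = 1" using assms by (simp_all add: dot_square_norm)
  have bb: "b \<bullet> b = 1" "b \<bullet> t = 0" "b \<bullet> n = 0"
    using norm_cross assms by (simp_all add: b_def dot_square_norm dot_cross_self)
  have "y \<bullet> t = 0" "y \<bullet> n = 0"
    using assms tt by (simp_all add: y_def inner_diff_left inner_diff_right inner_commute)
  then have "cross3 y b = 0"
    by (simp add: b_def Lagrange)
  then have "cross3 b (cross3 y b) = 0" by simp
  then have "y = (b \<bullet> y) *\<^sub>R b"
    by (simp add: Lagrange bb)
  moreover have "b \<bullet> y = x \<bullet> b"
    by (simp add: y_def inner_diff_right bb inner_commute)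
  ultimately show ?thesis
    unfolding b_def[symmetric] by (simp add: y_def algebra_simps)
qed

lemma smooth_curve_on_unit_tangent:
  assumes "open I" "smooth_curve_on I c" "\<And>s. s \<in> I \<Longrightarrow> vderiv c s \<noteq> 0"
  shows "smooth_curve_on I (unit_tangent c)"
proof -
  have "unit_tangent c = (\<lambda>s. vderiv c s /\<^sub>R norm (vderiv c s))"
    by (simp add: unit_tangent_def arclen_deriv_def fun_eq_iff)
  then show ?thesis
    using smooth_curve_on_normalize[OF assms(1) smooth_curve_on_vderiv[OF assms(2)] assms(3)] by simp
qed

lemma norm_unit_tangent: "vderiv c s \<noteq> 0 \<Longrightarrow> norm (unit_tangent c s) = 1"
  by (simp add: unit_tangent_def arclen_deriv_def)

lemma curvature_pos_iff:
  assumes "vderiv c s \<noteq> 0"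
  shows "curvature c s > 0 \<longleftrightarrow> vderiv (unit_tangent c) s \<noteq> 0"
  using assms by (simp add: curvature_def arclen_deriv_def zero_less_mult_iff)

text \<open>Both sides are the derivative of the unit tangent divided by its length; the speed of \<open>c\<close>
  cancels. When that derivative vanishes, both sides are \<open>0\<close>.\<close>

lemma unit_tangent_tangent_indicatrix:
  assumes "vderiv c s \<noteq> 0"
  shows "unit_tangent (tangent_indicatrix c) s = principal_normal c s"
  using assms
  by (simp add: unit_tangent_def tangent_indicatrix_def principal_normal_def curvature_def
      arclen_deriv_def)

text \<open>A curve on the sphere has \<open>T \<bullet> c = 0\<close>. Differentiating once more gives \<open>T' \<bullet> c = - |c'|\<close>, so
  \<open>T'\<close> cannot vanish where the curve is regular.\<close>

lemma frenet_curve_if_regular_spherical: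
  assumes "open I" "smooth_curve_on I c" "\<And>s. s \<in> I \<Longrightarrow> vderiv c s \<noteq> 0" "on_unit_sphere I c"
  shows "frenet_curve I c"
proof -
  have "curvature c s > 0" if s: "s \<in> I" for s
  proof -
    have n: "norm (c s) = 1" if "s \<in> I" for s
      using assms(4) that by (auto simp: on_unit_sphere_def)
    have dc: "(c has_vector_derivative vderiv c s) (at s)" if "s \<in> I" for s
      using smooth_curve_on_has_deriv[OF assms(2) that] .
    have dT: "(unit_tangent c has_vector_derivative vderiv (unit_tangent c) s) (at s)"
      using smooth_curve_on_has_deriv[OF smooth_curve_on_unit_tangent s] assms by blast
    have "unit_tangent c s \<bullet> c s = 0" if "s \<in> I" for s
      using norm_const_imp_orthogonal_deriv[OF assms(1) that n dc[OF that]]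
      by (simp add: unit_tangent_def arclen_deriv_def inner_commute)
    then have "vderiv (unit_tangent c) s \<bullet> c s = - (unit_tangent c s \<bullet> vderiv c s)"
      by (rule orthogonal_imp_inner_deriv[OF assms(1) s _ dT dc[OF s]])
    also have "\<dots> = - norm (vderiv c s)"
      using assms(3)[OF s]
      by (simp add: unit_tangent_def arclen_deriv_def dot_square_norm power2_eq_square)
    finally have "vderiv (unit_tangent c) s \<noteq> 0"
      using assms(3)[OF s] by auto
    with curvature_pos_iff[of c s] assms(3)[OF s] show ?thesis by simp
  qed
  with assms show ?thesis by (simp add: frenet_curve_def)
qed

lemma frenet_curve_tangent_indicatrix:
  assumes "open I" "frenet_curve I c"
  shows "frenet_curve I (tangent_indicatrix c)" "on_unit_sphere I (tangent_indicatrix c)"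
proof -
  have c: "smooth_curve_on I c" "\<And>s. s \<in> I \<Longrightarrow> vderiv c s \<noteq> 0" "\<And>s. s \<in> I \<Longrightarrow> curvature c s > 0"
    using assms by (auto simp: frenet_curve_def)
  show sph: "on_unit_sphere I (tangent_indicatrix c)"
    using norm_unit_tangent c by (auto simp: on_unit_sphere_def tangent_indicatrix_def)
  show "frenet_curve I (tangent_indicatrix c)"
    using frenet_curve_if_regular_spherical[OF assms(1) _ _ sph]
      smooth_curve_on_unit_tangent[OF assms(1) c(1,2)] curvature_pos_iff c(2,3)
    by (simp add: tangent_indicatrix_def)
qed

lemma principal_normal_smooth:
  assumes "open I" "frenet_curve I c"
  shows "smooth_curve_on I (principal_normal c)"
proof -
  have c: "smooth_curve_on I (tangent_indicatrix c)" "\<And>s. s \<in> I \<Longrightarrow> vderiv (tangent_indicatrix c) s \<noteq> 0"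
    using frenet_curve_tangent_indicatrix[OF assms] by (auto simp: frenet_curve_def)
  show ?thesis
    by (rule smooth_curve_on_cong[OF assms(1) _ smooth_curve_on_unit_tangent[OF assms(1) c]])
       (use unit_tangent_tangent_indicatrix assms(2) in \<open>auto simp: frenet_curve_def\<close>)
qed

lemma frenet_frame_orthonormal:
  assumes "open I" "frenet_curve I c" "s \<in> I"
  shows "norm (unit_tangent c s) = 1" "norm (principal_normal c s) = 1"
    "unit_tangent c s \<bullet> principal_normal c s = 0"
proof -
  have v: "\<And>s. s \<in> I \<Longrightarrow> vderiv c s \<noteq> 0"
    using assms by (auto simp: frenet_curve_def)
  then show "norm (unit_tangent c s) = 1"
    using norm_unit_tangent assms by blast
  show "norm (principal_normal c s) = 1"
    using assms(2,3) by (auto simp: frenet_curve_def principal_normal_def curvature_def)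
  have "unit_tangent c s \<bullet> vderiv (unit_tangent c) s = 0"
  proof (rule norm_const_imp_orthogonal_deriv[OF assms(1,3)])
    show "(unit_tangent c has_vector_derivative vderiv (unit_tangent c) s) (at s)"
      using smooth_curve_on_has_deriv[OF smooth_curve_on_unit_tangent[OF assms(1) _ v] assms(3)] assms(2)
      by (simp add: frenet_curve_def)
  qed (use norm_unit_tangent v in blast)
  then show "unit_tangent c s \<bullet> principal_normal c s = 0"
    by (simp add: principal_normal_def arclen_deriv_def)
qed

text \<open>Serret--Frenet for an arbitrary regular parameter, whence the factor \<open>v\<close>. The first equation
  is the definition of the normal. Since \<open>B' = T \<times> N'\<close> is orthogonal to \<open>T\<close>, and \<open>|B| = 1\<close>
  makes it orthogonal to \<open>B\<close>, it has only an \<open>N\<close> component, which defines the torsion; the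
  components of \<open>N'\<close> follow by differentiating
  \<open>N \<bullet> T = 0\<close>, \<open>N \<bullet> N = 1\<close> and \<open>N \<bullet> B = 0\<close>.\<close>

lemma frenet_equations:
  assumes "open I" "frenet_curve I c" "s \<in> I"
  defines "v \<equiv> norm (vderiv c s)"
  shows "(unit_tangent c has_vector_derivative
            (v * curvature c s) *\<^sub>R principal_normal c s) (at s)"
    and "(principal_normal c has_vector_derivative
            v *\<^sub>R (torsion c s *\<^sub>R binormal c s - curvature c s *\<^sub>R unit_tangent c s)) (at s)"
    and "(binormal c has_vector_derivative
            - (v * torsion c s) *\<^sub>R principal_normal c s) (at s)"
proof -
  define T N B where "T = unit_tangent c" and "N = principal_normal c" and "B = binormal c"
  define k t where "k = curvature c s" and "t = torsion c s"
  note TNB = T_def N_def B_def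
  have c: "smooth_curve_on I c" "\<And>s. s \<in> I \<Longrightarrow> vderiv c s \<noteq> 0" and k: "k > 0"
    using assms by (auto simp: frenet_curve_def k_def)
  have v: "v > 0" using c(2) assms(3) by (simp add: v_def)
  have ortho: "norm (T s) = 1" "norm (N s) = 1" "T s \<bullet> N s = 0" if "s \<in> I" for s
    using frenet_frame_orthonormal[OF assms(1,2) that] by (simp_all add: TNB)
  have B: "B s = cross3 (T s) (N s)" for s
    by (simp add: TNB binormal_def)
  have Bo: "B s \<bullet> T s = 0" "B s \<bullet> N s = 0" for s
    by (simp_all add: B dot_cross_self)
  have Bn: "norm (B s) = 1" if "s \<in> I" for s
  proof -
    have "(norm (B s))\<^sup>2 = 1"
      unfolding B norm_cross using ortho[OF that] by simp
    then show ?thesis by (simp add: power2_eq_1_iff) (smt (verit) norm_ge_zero)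
  qed
  have dT0: "(T has_vector_derivative vderiv T s) (at s)"
    unfolding TNB by (rule smooth_curve_on_has_deriv[OF smooth_curve_on_unit_tangent[OF assms(1) c] assms(3)])
  have T': "vderiv T s = (v * k) *\<^sub>R N s"
    using k v by (simp add: TNB v_def k_def principal_normal_def arclen_deriv_def field_simps)
  note dT = dT0[unfolded T']
  from dT show "(unit_tangent c has_vector_derivative
            (v * curvature c s) *\<^sub>R principal_normal c s) (at s)"
    by (simp add: TNB k_def)
  obtain N' where N': "(N has_vector_derivative N') (at s)"
    using smooth_curve_on_has_deriv[OF principal_normal_smooth[OF assms(1,2)] assms(3)] TNB by blast
  have dB0: "(B has_vector_derivative (cross3 (T s) N' + cross3 ((v * k) *\<^sub>R N s) (N s))) (at s)"
    using bounded_bilinear.has_vector_derivative[OF bilinear_conv_bounded_bilinear[THEN iffD1, OF bilinear_cross] dT N']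
    by (simp add: B[abs_def])
  define B' where "B' = cross3 (T s) N' + cross3 ((v * k) *\<^sub>R N s) (N s)"
  note dB1 = dB0[folded B'_def]
  have "B' = cross3 (T s) N'"
    by (simp add: B'_def cross_mult_left)
  then have "B' \<bullet> T s = 0"
    by (simp add: dot_cross_self)
  moreover have "B' \<bullet> B s = 0"
    using norm_const_imp_orthogonal_deriv[OF assms(1,3) Bn dB1] by (simp add: inner_commute)
  moreover have "B' \<bullet> N s = - (v * t)"
    using v vector_derivative_at[OF dB1]
    by (simp add: t_def torsion_def arclen_deriv_def TNB v_def)
  ultimately have B'_eq: "B' = - (v * t) *\<^sub>R N s"
    using orthonormal_cross3_expansion[OF ortho[OF assms(3)], of B'] by (simp add: B)
  note dB = dB1[unfolded B'_eq]
  from dB show "(binormal c has_vector_derivative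
            - (v * torsion c s) *\<^sub>R principal_normal c s) (at s)"
    by (simp add: TNB t_def)
  have NN: "N s \<bullet> N s = 1"
    using ortho[OF assms(3)] by (simp add: dot_square_norm)
  have "N' \<bullet> T s = - (v * k)"
    using orthogonal_imp_inner_deriv[OF assms(1,3) _ N' dT] ortho NN by (simp add: inner_commute)
  moreover have "N' \<bullet> B s = v * t"
    using orthogonal_imp_inner_deriv[OF assms(1,3) _ N' dB] Bo NN by (simp add: inner_commute)
  moreover have "N' \<bullet> N s = 0"
    using norm_const_imp_orthogonal_deriv[OF assms(1,3) ortho(2) N'] by (simp add: inner_commute)
  ultimately have "N' = v *\<^sub>R (t *\<^sub>R B s - k *\<^sub>R T s)"
    using orthonormal_cross3_expansion[OF ortho[OF assms(3)], of N']
    by (simp add: B algebra_simps)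
  with N' show "(principal_normal c has_vector_derivative
            v *\<^sub>R (torsion c s *\<^sub>R binormal c s - curvature c s *\<^sub>R unit_tangent c s)) (at s)"
    by (simp add: TNB t_def k_def)
qed

section \<open>Generalized helices and slant helices\<close>

lemma constant_angle_imp_normal_orthogonal:
  assumes "open I" "frenet_curve I c" "s \<in> I" "\<And>s. s \<in> I \<Longrightarrow> unit_tangent c s \<bullet> d = a"
  shows "principal_normal c s \<bullet> d = 0"
proof -
  have "((\<lambda>s. unit_tangent c s \<bullet> d) has_vector_derivative
      ((norm (vderiv c s) * curvature c s) *\<^sub>R principal_normal c s) \<bullet> d) (at s)"
    by (rule bounded_linear.has_vector_derivative[OF bounded_linear_inner_left
          frenet_equations(1)[OF assms(1-3)]])
  moreover have "((\<lambda>s. unit_tangent c s \<bullet> d) has_vector_derivative 0) (at s)"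
    by (rule has_vector_derivative_transform_within_open[OF has_vector_derivative_const[of a] assms(1,3)])
       (simp add: assms(4))
  ultimately have "((norm (vderiv c s) * curvature c s) *\<^sub>R principal_normal c s) \<bullet> d = 0"
    by (rule vector_derivative_unique_at)
  moreover have "norm (vderiv c s) \<noteq> 0" "curvature c s \<noteq> 0"
    using assms(2,3) by (auto simp: frenet_curve_def)
  ultimately show ?thesis by simp
qed

text \<open>Lancret's theorem. If \<open>g = \<tau>/\<kappa>\<close> is constant, then \<open>g T + B\<close> has derivative zero and is the
  axis, up to normalization. Conversely, an axis \<open>d\<close> is orthogonal to \<open>N\<close>, hence
  \<open>d = a T + b B\<close> with \<open>b\<close> constant as well, and \<open>N' \<bullet> d = 0\<close> reads \<open>\<tau> b = \<kappa> a\<close>.\<close>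

theorem generalized_helix_iff_constant_angle:
  assumes "open I" "is_interval I" "frenet_curve I c"
  shows "generalized_helix I c \<longleftrightarrow>
    (\<exists>d \<theta>. norm d = 1 \<and> (\<forall>s\<in>I. unit_tangent c s \<bullet> d = cos \<theta>))"
proof
  have v: "norm (vderiv c s) > 0" and k: "curvature c s > 0" if "s \<in> I" for s
    using assms(3) that by (auto simp: frenet_curve_def)
  note ortho = frenet_frame_orthonormal[OF assms(1,3)]
  note frenet = frenet_equations[OF assms(1,3)]
  have conv: "convex I"
    using assms(2) is_interval_convex by blast
  {
    assume "generalized_helix I c"
    then obtain g where g: "\<And>s. s \<in> I \<Longrightarrow> torsion c s / curvature c s = g"
      by (auto simp: generalized_helix_def)
    define D where "D s = g *\<^sub>R unit_tangent c s + binormal c s" for s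
    have "(D has_vector_derivative 0) (at s within I)" if s: "s \<in> I" for s
    proof -
      have t: "torsion c s = g * curvature c s"
        using g[OF s] k[OF s] by (simp add: field_simps)
      have "((\<lambda>s. g *\<^sub>R unit_tangent c s + binormal c s) has_vector_derivative
          (g *\<^sub>R ((norm (vderiv c s) * curvature c s) *\<^sub>R principal_normal c s)
            + - (norm (vderiv c s) * torsion c s) *\<^sub>R principal_normal c s)) (at s)"
        by (intro has_vector_derivative_add frenet(3)[OF s]
            bounded_linear.has_vector_derivative[OF bounded_linear_scaleR_right frenet(1)[OF s]])
      then show ?thesis
        unfolding D_def by (simp add: t mult_ac has_vector_derivative_at_within)
    qed
    then obtain d0 where d0: "\<And>s. s \<in> I \<Longrightarrow> D s = d0"
      using has_vector_derivative_zero_constant[OF conv] by blast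
    have Td0: "unit_tangent c s \<bullet> d0 = g" if "s \<in> I" for s
      using ortho(1)[OF that]
      by (simp add: d0[OF that, symmetric] D_def inner_add_right binormal_def dot_cross_self
          dot_square_norm)
    show "\<exists>d \<theta>. norm d = 1 \<and> (\<forall>s\<in>I. unit_tangent c s \<bullet> d = cos \<theta>)"
    proof (cases "I = {}")
      case True
      then show ?thesis using vector_choose_size[of 1] by auto
    next
      case False
      then obtain s0 where s0: "s0 \<in> I" by blast
      have "d0 \<bullet> binormal c s0 = 1"
      proof -
        have "(norm (binormal c s0))\<^sup>2 = 1"
          unfolding binormal_def norm_cross using ortho[OF s0] by simp
        then show ?thesis
          unfolding d0[OF s0, symmetric] D_def inner_add_left
          by (simp add: dot_square_norm) (simp add: binormal_def dot_cross_self)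
      qed
      then have nz: "d0 \<noteq> 0" by auto
      define d where "d = d0 /\<^sub>R norm d0"
      have nd: "norm d = 1" using nz by (simp add: d_def)
      \<comment> \<open>The constant value is a cosine because both vectors have norm 1.\<close>
      have "\<bar>unit_tangent c s0 \<bullet> d\<bar> \<le> 1"
        using Cauchy_Schwarz_ineq2[of "unit_tangent c s0" d] nd ortho(1)[OF s0] by simp
      then have "unit_tangent c s0 \<bullet> d = cos (arccos (unit_tangent c s0 \<bullet> d))"
        by (simp add: cos_arccos_abs)
      moreover have "unit_tangent c s \<bullet> d = unit_tangent c s0 \<bullet> d" if "s \<in> I" for s
        using Td0[OF that] Td0[OF s0] by (simp add: d_def)
      ultimately show ?thesis using nd by metis
    qed
  next
    assume "\<exists>d \<theta>. norm d = 1 \<and> (\<forall>s\<in>I. unit_tangent c s \<bullet> d = cos \<theta>)"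
    then obtain d a where d: "norm d = 1" and Td: "\<And>s. s \<in> I \<Longrightarrow> unit_tangent c s \<bullet> d = a"
      by blast
    have Nd: "principal_normal c s \<bullet> d = 0" if "s \<in> I" for s
      using constant_angle_imp_normal_orthogonal[OF assms(1,3) that Td] .
    have "((\<lambda>s. binormal c s \<bullet> d) has_vector_derivative 0) (at s within I)" if "s \<in> I" for s
      using bounded_linear.has_vector_derivative[OF bounded_linear_inner_left[of d] frenet(3)[OF that]] Nd[OF that]
      by (simp add: has_vector_derivative_at_within)
    then obtain b where b: "\<And>s. s \<in> I \<Longrightarrow> binormal c s \<bullet> d = b"
      using has_vector_derivative_zero_constant[OF conv] by blast
    have "torsion c s / curvature c s = a / b" if s: "s \<in> I" for s
    proof -
      have "((\<lambda>s. principal_normal c s \<bullet> d) has_vector_derivative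
          (norm (vderiv c s) *\<^sub>R (torsion c s *\<^sub>R binormal c s - curvature c s *\<^sub>R unit_tangent c s)) \<bullet> d) (at s)"
        by (rule bounded_linear.has_vector_derivative[OF bounded_linear_inner_left frenet(2)[OF s]])
      moreover have "((\<lambda>s. principal_normal c s \<bullet> d) has_vector_derivative 0) (at s)"
        by (rule has_vector_derivative_transform_within_open[OF has_vector_derivative_const[of 0] assms(1) s])
           (simp add: Nd)
      ultimately have "(norm (vderiv c s) *\<^sub>R
          (torsion c s *\<^sub>R binormal c s - curvature c s *\<^sub>R unit_tangent c s)) \<bullet> d = 0"
        by (rule vector_derivative_unique_at)
      then have eq: "torsion c s * b = curvature c s * a"
        using v[OF s] b[OF s] Td[OF s] by (simp add: inner_diff_left)
      have "d = a *\<^sub>R unit_tangent c s + b *\<^sub>R binormal c s"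
        using orthonormal_cross3_expansion[OF ortho[OF s], of d] Td[OF s] b[OF s] Nd[OF s]
        by (simp add: inner_commute binormal_def)
      \<comment> \<open>If \<open>b\<close> were \<open>0\<close>, then \<open>\<kappa> a = 0\<close> would force \<open>a = 0\<close> and so \<open>d = 0\<close>.\<close>
      then have "b \<noteq> 0"
        using eq d k[OF s] by force
      with eq k[OF s] show ?thesis by (simp add: field_simps)
    qed
    with assms(3) show "generalized_helix I c"
      by (auto simp: generalized_helix_def)
  }
qed

theorem spherical_helix_tangent_indicatrix_iff_slant_helix:
  assumes "open I" "is_interval I" "frenet_curve I c"
  shows "spherical_helix I (tangent_indicatrix c) \<longleftrightarrow> slant_helix I c"
proof -
  have "\<And>s. s \<in> I \<Longrightarrow> unit_tangent (tangent_indicatrix c) s = principal_normal c s"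
    using assms(3) unit_tangent_tangent_indicatrix by (auto simp: frenet_curve_def)
  then show ?thesis
    using generalized_helix_iff_constant_angle[OF assms(1,2) frenet_curve_tangent_indicatrix(1)]
      frenet_curve_tangent_indicatrix(2) assms
    by (auto simp: spherical_helix_def slant_helix_def)
qed

text \<open>The axis of the helix is orthogonal to every principal normal.\<close>

lemma generalized_helix_imp_slant_helix:
  assumes "open I" "is_interval I" "generalized_helix I c"
  shows "slant_helix I c"
proof -
  have c: "frenet_curve I c" using assms(3) by (simp add: generalized_helix_def)
  obtain d \<theta> where d: "norm d = 1" "\<And>s. s \<in> I \<Longrightarrow> unit_tangent c s \<bullet> d = cos \<theta>"
    using generalized_helix_iff_constant_angle[OF assms(1,2) c] assms(3) by blast
  have "principal_normal c s \<bullet> d = cos (pi / 2)" if "s \<in> I" for s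
    using constant_angle_imp_normal_orthogonal[OF assms(1) c that d(2)] by simp
  then show ?thesis
    using c d(1) unfolding slant_helix_def by blast
qed

section \<open>Involutes\<close>

text \<open>The terms \<open>T\<close> and \<open>- T\<close> cancel in the derivative of \<open>\<gamma> + (c - s) T\<close>, which leaves a positive
  multiple of \<open>N\<close>. Hence the unit tangent of the involute is \<open>N\<close>, whose derivative has the
  component \<open>- \<kappa>\<close> along \<open>T\<close>.\<close>

lemma frenet_curve_involute:
  assumes "open I" "frenet_curve I \<gamma>" "arclength_parametrized I \<gamma>" "\<And>s. s \<in> I \<Longrightarrow> c - s > 0"
  shows "frenet_curve I (involute \<gamma> c)"
proof -
  define T where "T = unit_tangent \<gamma>"
  have \<gamma>: "smooth_curve_on I \<gamma>" "\<And>s. s \<in> I \<Longrightarrow> vderiv \<gamma> s \<noteq> 0" "\<And>s. s \<in> I \<Longrightarrow> curvature \<gamma> s > 0"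
    using assms(2) by (auto simp: frenet_curve_def)
  note ortho = frenet_frame_orthonormal[OF assms(1,2)]
  have speed: "norm (vderiv \<gamma> s) = 1" if "s \<in> I" for s
    using assms(3) that by (simp add: arclength_parametrized_def)
  have T: "smooth_curve_on I T"
    unfolding T_def by (rule smooth_curve_on_unit_tangent[OF assms(1) \<gamma>(1,2)])
  have inv: "involute \<gamma> c = (\<lambda>s. \<gamma> s + (c - s) *\<^sub>R T s)"
    by (simp add: involute_def T_def fun_eq_iff)
  have lin: "times_differentiable_on n I (\<lambda>s. c - s)" for n
  proof (cases n)
    case (Suc m)
    show ?thesis unfolding Suc
      by (rule times_differentiable_on_SucI[OF assms(1) _ times_differentiable_on_const[of m I "-1"]])
         (auto intro!: derivative_eq_intros)
  qed simp
  have smooth: "smooth_curve_on I (involute \<gamma> c)"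
    using \<gamma>(1) T unfolding inv smooth_curve_on_iff_times
    by (intro allI times_differentiable_on_add[OF assms(1)] lin
        bounded_bilinear.times_differentiable_on[OF bounded_bilinear_scaleR assms(1)]) auto
  have d\<gamma>: "(\<gamma> has_vector_derivative T s) (at s)" if "s \<in> I" for s
    using smooth_curve_on_has_deriv[OF \<gamma>(1) that] speed[OF that]
    by (simp add: T_def unit_tangent_def arclen_deriv_def)
  have dT: "(T has_vector_derivative curvature \<gamma> s *\<^sub>R principal_normal \<gamma> s) (at s)" if "s \<in> I" for s
    using frenet_equations(1)[OF assms(1,2) that] speed[OF that] by (simp add: T_def)
  have "(involute \<gamma> c has_vector_derivative
      ((c - s) * curvature \<gamma> s) *\<^sub>R principal_normal \<gamma> s) (at s)" if "s \<in> I" for s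
  proof -
    have "((\<lambda>s. \<gamma> s + (c - s) *\<^sub>R T s) has_vector_derivative
        (T s + ((c - s) *\<^sub>R (curvature \<gamma> s *\<^sub>R principal_normal \<gamma> s) + (-1) *\<^sub>R T s))) (at s)"
      by (intro has_vector_derivative_add d\<gamma>[OF that] has_vector_derivative_scaleR dT[OF that])
         (auto intro!: derivative_eq_intros)
    then show ?thesis unfolding inv by simp
  qed
  then have inv': "vderiv (involute \<gamma> c) s = ((c - s) * curvature \<gamma> s) *\<^sub>R principal_normal \<gamma> s"
    if "s \<in> I" for s using that vector_derivative_at by blast
  have reg: "vderiv (involute \<gamma> c) s \<noteq> 0" if "s \<in> I" for s
    using inv'[OF that] assms(4)[OF that] \<gamma>(3)[OF that] ortho(2)[OF that] by auto
  have N: "unit_tangent (involute \<gamma> c) s = principal_normal \<gamma> s" if "s \<in> I" for s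
  proof -
    define m where "m = (c - s) * curvature \<gamma> s"
    have "m > 0"
      using assms(4)[OF that] \<gamma>(3)[OF that] by (simp add: m_def)
    moreover have "vderiv (involute \<gamma> c) s = m *\<^sub>R principal_normal \<gamma> s"
      using inv'[OF that] by (simp add: m_def)
    ultimately show ?thesis
      using ortho(2)[OF that] by (simp add: unit_tangent_def arclen_deriv_def)
  qed
  have "curvature (involute \<gamma> c) s > 0" if s: "s \<in> I" for s
  proof -
    note dN = smooth_curve_on_has_deriv[OF smooth_curve_on_unit_tangent[OF assms(1) smooth reg] s]
    have "vderiv (unit_tangent (involute \<gamma> c)) s \<bullet> T s
        = - (unit_tangent (involute \<gamma> c) s \<bullet> (curvature \<gamma> s *\<^sub>R principal_normal \<gamma> s))"
      by (rule orthogonal_imp_inner_deriv[OF assms(1) s _ dN dT[OF s]])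
         (simp add: N T_def ortho(3) inner_commute[of "principal_normal _ _"])
    also have "\<dots> = - curvature \<gamma> s"
      using ortho(2)[OF s] by (simp add: N[OF s] dot_square_norm)
    finally have "vderiv (unit_tangent (involute \<gamma> c)) s \<noteq> 0"
      using \<gamma>(3)[OF s] by auto
    then show ?thesis
      using curvature_pos_iff[of "involute \<gamma> c" s] reg[OF s] by simp
  qed
  with smooth reg show ?thesis by (simp add: frenet_curve_def)
qed

theorem theorem6:
  fixes I :: "real set" and \<gamma> :: "real \<Rightarrow> real^3" and c :: real
  assumes "open I" and "is_interval I" and "I \<noteq> {}"
    and "smooth_curve_on I \<gamma>"
    and "arclength_parametrized I \<gamma>"
    and "\<And>s. s \<in> I \<Longrightarrow> curvature \<gamma> s \<noteq> 0"
    and "\<And>s. s \<in> I \<Longrightarrow> c - s > 0"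
  shows "(spherical_helix I (tangent_indicatrix (involute \<gamma> c)) \<longleftrightarrow>
            slant_helix I (involute \<gamma> c)) \<and>
         (slant_helix I (involute \<gamma> c) \<longrightarrow>
            slant_helix I (tangent_indicatrix (involute \<gamma> c)) \<and>
            on_unit_sphere I (tangent_indicatrix (involute \<gamma> c)))"
proof -
  have "vderiv \<gamma> s \<noteq> 0" "curvature \<gamma> s > 0" if "s \<in> I" for s
    using assms(5) assms(6)[OF that] that
    by (auto simp: arclength_parametrized_def curvature_def)
  then have "frenet_curve I \<gamma>"
    using assms(4) by (simp add: frenet_curve_def)
  then have "frenet_curve I (involute \<gamma> c)"
    using frenet_curve_involute[OF assms(1) _ assms(5,7)] by blast
  then have iff: "spherical_helix I (tangent_indicatrix (involute \<gamma> c)) \<longleftrightarrow>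
      slant_helix I (involute \<gamma> c)"
    by (rule spherical_helix_tangent_indicatrix_iff_slant_helix[OF assms(1,2)])
  moreover have "slant_helix I (tangent_indicatrix (involute \<gamma> c))"
    if "spherical_helix I (tangent_indicatrix (involute \<gamma> c))"
    using that generalized_helix_imp_slant_helix[OF assms(1,2)] by (simp add: spherical_helix_def)
  ultimately show ?thesis
    by (auto simp: spherical_helix_def)
qed

end
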